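(* Let $n\ge 0$ be an integer, let $\lambda\in(0,1)$, and let $X_1,\dots,X_n$ be independent Bernoulli random variables with $P\{X_j=1\}=\frac{1}{j}$ and $P\{X_j=0\}=1-\frac1j$ for $j=1,\dots,n$; put $Y_n=X_1+\cdots+X_n$. Then for every integer $l$ with $0\le l\le n$, $$\sum_{m=l}^{n}S_{2,\lambda}(n+1,m+1)\,S_1(m+1,l+1)=(-1)^{n-l}\lambda^{n-l}\,n!\,E\Big[\binom{Y_n}{l}\Big].$$
   Context: For real $x$, $(x)_0=1$ and $(x)_n=x(x-1)\cdots(x-n+1)$ for $n\ge1$; the (signed) Stirling numbers of the first kind $S_1(n,l)$ are defined by $(x)_n=\sum_{l=0}^n S_1(n,l)x^l$. The degenerate falling factorial is $(x)_{0,\lambda}=1$, $(x)_{n,\lambda}=x(x-\lambda)(x-2\lambda)\cdots(x-(n-1)\lambda)$ for $n\ge1$, and the degenerate Stirling numbers of the second kind $S_{2,\lambda}(n,l)$ are defined by $(x)_{n,\lambda}=\sum_{l=0}^n S_{2,\lambda}(n,l)(x)_l$. Also $\binom{y}{l}=\frac{(y)_l}{l!}$ and $E$ denotes expectation. *)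

theory Defs
  imports "HOL-Probability.Probability" "HOL-Computational_Algebra.Polynomial"
begin

definition falling :: "real \<Rightarrow> nat \<Rightarrow> real"
  where "falling x n = (\<Prod>i<n. x - real i)"

definition degen_falling :: "real \<Rightarrow> real \<Rightarrow> nat \<Rightarrow> real"
  where "degen_falling lam x n = (\<Prod>i<n. x - real i * lam)"

text \<open>
  The Stirling numbers are the coefficients in the expansions that define them; the lemmas
  \<open>stirling1_ex1\<close> and \<open>degen_stirling2_ex1\<close> below show that both descriptions are
  well defined. The numbers vanish for \<open>l > n\<close>.
\<close>

definition stirling1 :: "nat \<Rightarrow> nat \<Rightarrow> real"
  where "stirling1 n = (THE c. (\<forall>l>n. c l = 0) \<and>
           (\<forall>x. falling x n = (\<Sum>l\<le>n. c l * x ^ l)))"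

definition degen_stirling2 :: "real \<Rightarrow> nat \<Rightarrow> nat \<Rightarrow> real"
  where "degen_stirling2 lam n = (THE c. (\<forall>l>n. c l = 0) \<and>
           (\<forall>x. degen_falling lam x n = (\<Sum>l\<le>n. c l * falling x l)))"

lemma newton_expansion_ex:
  fixes a e :: "nat \<Rightarrow> real"
  shows "\<exists>c. (\<forall>l>n. c l = 0) \<and>
           (\<forall>x. (\<Prod>i<n. x - e i) = (\<Sum>l\<le>n. c l * (\<Prod>i<l. x - a i)))"
proof (induction n)
  case 0
  show ?case by (rule exI[of _ "\<lambda>l. if l = 0 then 1 else 0"]) simp
next
  case (Suc n)
  then obtain c where c0: "\<And>l. l > n \<Longrightarrow> c l = 0"
    and c: "\<And>x. (\<Prod>i<n. x - e i) = (\<Sum>l\<le>n. c l * (\<Prod>i<l. x - a i))"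
    by blast
  define d where "d l = (if l = 0 then 0 else c (l - 1)) + (a l - e n) * c l" for l
  have "(\<Prod>i<Suc n. x - e i) = (\<Sum>l\<le>Suc n. d l * (\<Prod>i<l. x - a i))" for x
  proof -
    let ?b = "\<lambda>l. \<Prod>i<l. x - a i"
    have "(\<Prod>i<Suc n. x - e i) = (\<Sum>l\<le>n. c l * ?b l) * (x - e n)"
      by (simp add: c)
    also have "\<dots> = (\<Sum>l\<le>n. c l * ?b (Suc l)) + (\<Sum>l\<le>n. (a l - e n) * c l * ?b l)"
      unfolding sum_distrib_right sum.distrib[symmetric]
      by (rule sum.cong) (auto simp: algebra_simps)
    also have "(\<Sum>l\<le>n. c l * ?b (Suc l)) =
        (\<Sum>l\<le>Suc n. (if l = 0 then 0 else c (l - 1)) * ?b l)"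
      by (simp only: sum.atMost_Suc_shift) simp
    also have "(\<Sum>l\<le>n. (a l - e n) * c l * ?b l) = (\<Sum>l\<le>Suc n. (a l - e n) * c l * ?b l)"
      by (simp add: c0)
    finally show ?thesis
      by (simp only: sum.distrib[symmetric] d_def distrib_right)
  qed
  moreover have "\<forall>l>Suc n. d l = 0"
    by (auto simp: d_def c0)
  ultimately show ?case by blast
qed

lemma newton_expansion_zero:
  fixes a :: "nat \<Rightarrow> real"
  assumes "\<And>x. (\<Sum>l\<le>n. c l * (\<Prod>i<l. x - a i)) = 0" "l \<le> n"
  shows "c l = 0"
  using assms
proof (induction n)
  case 0
  then show ?case by simp
next
  case (Suc n)
  define b where "b l = (\<Prod>i<l. [:- a i, 1:])" for l
  have deg: "degree (b l) = l" for l
    by (simp add: b_def degree_prod_sum_eq)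
  have lead: "coeff (b l) l = 1" for l
    using lead_coeff_prod[of "\<lambda>i. [:- a i, 1:]" "{..<l}"] deg[of l]
    by (simp add: b_def)
  have "poly (\<Sum>l\<le>Suc n. smult (c l) (b l)) x = 0" for x
    using Suc.prems(1)[of x] by (simp add: b_def poly_sum poly_prod algebra_simps)
  then have "poly (\<Sum>l\<le>Suc n. smult (c l) (b l)) = poly 0"
    by (simp only: fun_eq_iff poly_0 simp_thms)
  then have "(\<Sum>l\<le>Suc n. smult (c l) (b l)) = 0"
    by (simp only: poly_eq_poly_eq_iff)
  then have "coeff (\<Sum>l\<le>Suc n. smult (c l) (b l)) (Suc n) = 0"
    by simp
  moreover have "coeff (\<Sum>l\<le>n. smult (c l) (b l)) (Suc n) = 0"
    unfolding coeff_sum by (rule sum.neutral) (auto simp: deg coeff_eq_0)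
  ultimately have top: "c (Suc n) = 0"
    using lead[of "Suc n"] by simp
  show ?case
  proof (cases "l = Suc n")
    case False
    have "(\<Sum>l\<le>n. c l * (\<Prod>i<l. x - a i)) = 0" for x
      using Suc.prems(1)[of x] top by simp
    with False Suc show ?thesis by simp
  qed (use top in simp)
qed

lemma newton_expansion_ex1:
  fixes a e :: "nat \<Rightarrow> real"
  shows "\<exists>!c. (\<forall>l>n. c l = 0) \<and>
           (\<forall>x. (\<Prod>i<n. x - e i) = (\<Sum>l\<le>n. c l * (\<Prod>i<l. x - a i)))"
proof (rule ex_ex1I[OF newton_expansion_ex])
  fix c d
  assume c: "(\<forall>l>n. c l = 0) \<and>
      (\<forall>x. (\<Prod>i<n. x - e i) = (\<Sum>l\<le>n. c l * (\<Prod>i<l. x - a i)))"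
    and d: "(\<forall>l>n. d l = 0) \<and>
      (\<forall>x. (\<Prod>i<n. x - e i) = (\<Sum>l\<le>n. d l * (\<Prod>i<l. x - a i)))"
  have "(\<Sum>l\<le>n. (c l - d l) * (\<Prod>i<l. x - a i)) = 0" for x
    unfolding left_diff_distrib sum_subtractf
    using conjunct2[OF c, THEN spec, of x] conjunct2[OF d, THEN spec, of x] by linarith
  then have "c l - d l = 0" if "l \<le> n" for l
    using newton_expansion_zero[where c = "\<lambda>l. c l - d l"] that by blast
  moreover have "c l = d l" if "l > n" for l
    using c d that by simp
  ultimately show "c = d"
    by (metis eq_iff_diff_eq_0 ext not_le)
qed

lemma stirling1_ex1:
  "\<exists>!c. (\<forall>l>n. c l = 0) \<and> (\<forall>x. falling x n = (\<Sum>l\<le>n. c l * x ^ l))"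
  using newton_expansion_ex1[of n real "\<lambda>_. 0"] by (simp add: falling_def)

lemma degen_stirling2_ex1:
  "\<exists>!c. (\<forall>l>n. c l = 0) \<and>
     (\<forall>x. degen_falling lam x n = (\<Sum>l\<le>n. c l * falling x l))"
  using newton_expansion_ex1[of n "\<lambda>i. real i * lam" real]
  by (simp add: falling_def degen_falling_def)

lemma
  shows falling_eq_sum_stirling1: "falling x n = (\<Sum>l\<le>n. stirling1 n l * x ^ l)"
    and stirling1_eq_0: "n < l \<Longrightarrow> stirling1 n l = 0"
  using theI'[OF stirling1_ex1[of n]] unfolding stirling1_def by blast+

lemma
  shows degen_falling_eq_sum_degen_stirling2:
      "degen_falling lam x n = (\<Sum>l\<le>n. degen_stirling2 lam n l * falling x l)"
    and degen_stirling2_eq_0: "n < l \<Longrightarrow> degen_stirling2 lam n l = 0"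
  using theI'[OF degen_stirling2_ex1[of n lam]] unfolding degen_stirling2_def by blast+

end

theory Submission
  imports Defs
begin

text \<open>
  Substituting the expansion of \<open>falling\<close> into that of \<open>degen_falling\<close> shows that the left-hand
  side is the coefficient of \<open>x ^ (l + 1)\<close> in \<open>\<Prod>i\<le>n. x - i * lam\<close>. For \<open>x = - lam * t\<close> this
  product is \<open>x * (- lam) ^ n * fact n * (\<Prod>j=1..n. 1 + t / j)\<close>, and by independence
  \<open>\<Prod>j=1..n. 1 + t / j\<close> is the expectation of \<open>\<Prod>j=1..n. 1 + t * X j = (1 + t) ^ Y\<close>, whose
  coefficients in \<open>t\<close> are the binomial moments of \<open>Y\<close>.
\<close>

lemma power_series_coeff_unique:
  fixes c d :: "nat \<Rightarrow> real"
  assumes "\<And>x. (\<Sum>k\<le>n. c k * x ^ k) = (\<Sum>k\<le>n. d k * x ^ k)" "k \<le> n"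
  shows "c k = d k"
  using assms polyfun_eq_coeffs[of c n d] by blast

text \<open>Each \<open>falling x m\<close> is expanded up to the common degree \<open>n\<close>,
  the extra coefficients being zero, so that the two summations can be swapped.\<close>

lemma degen_falling_eq_sum_power:
  "degen_falling lam x n =
    (\<Sum>k\<le>n. (\<Sum>m\<le>n. degen_stirling2 lam n m * stirling1 m k) * x ^ k)"
proof -
  have "falling x m = (\<Sum>k\<le>n. stirling1 m k * x ^ k)" if "m \<le> n" for m
    unfolding falling_eq_sum_stirling1 using that
    by (intro sum.mono_neutral_left) (auto simp: stirling1_eq_0)
  then have "degen_falling lam x n =
      (\<Sum>m\<le>n. degen_stirling2 lam n m * (\<Sum>k\<le>n. stirling1 m k * x ^ k))"
    unfolding degen_falling_eq_sum_degen_stirling2 by simp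
  also have "\<dots> = (\<Sum>m\<le>n. \<Sum>k\<le>n. degen_stirling2 lam n m * stirling1 m k * x ^ k)"
    by (simp add: sum_distrib_left mult.assoc)
  also have "\<dots> = (\<Sum>k\<le>n. (\<Sum>m\<le>n. degen_stirling2 lam n m * stirling1 m k) * x ^ k)"
    by (subst sum.swap) (simp add: sum_distrib_right)
  finally show ?thesis .
qed

text \<open>The factor with index 0 is \<open>x\<close>; the one with index \<open>j >= 1\<close>
  equals \<open>- lam * j * (1 + t / j)\<close> with \<open>t = - x / lam\<close>. The weights
  \<open>1 / real j\<close> will be matched with the Bernoulli parameters.\<close>

lemma degen_falling_Suc_eq_prod:
  assumes "lam \<noteq> 0"
  shows "degen_falling lam x (Suc n) =
    x * (- lam) ^ n * fact n * (\<Prod>j=1..n. 1 + (- x / lam) * (1 / real j))"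
proof (induction n)
  case 0
  show ?case by (simp add: degen_falling_def)
next
  case (Suc n)
  have "degen_falling lam x (Suc (Suc n)) = degen_falling lam x (Suc n) * (x - real (Suc n) * lam)"
    by (simp add: degen_falling_def)
  moreover have "x - real (Suc n) * lam =
      (- lam) * real (Suc n) * (1 + (- x / lam) * (1 / real (Suc n)))"
    using assms by (simp add: right_diff_distrib del: of_nat_Suc)
  ultimately show ?case
    unfolding Suc.IH by simp
qed

text \<open>Here \<open>k\<close> counts the indices where \<open>f\<close> is 1: each of them adds
  1 to the sum and contributes a factor \<open>1 + t\<close> to the product.\<close>

lemma zero_one_sum_eq_of_nat:
  fixes f :: "'b \<Rightarrow> real"
  assumes "finite A" "\<And>j. j \<in> A \<Longrightarrow> f j = 0 \<or> f j = 1"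
  obtains k where "k \<le> card A" "(\<Sum>j\<in>A. f j) = real k" "\<And>t. (\<Prod>j\<in>A. 1 + t * f j) = (1 + t) ^ k"
proof -
  have "\<exists>k\<le>card A. (\<Sum>j\<in>A. f j) = real k \<and> (\<forall>t. (\<Prod>j\<in>A. 1 + t * f j) = (1 + t) ^ k)"
    using assms
  proof (induction A rule: finite_induct)
    case empty
    show ?case by simp
  next
    case (insert a A)
    then obtain k where k: "k \<le> card A" "(\<Sum>j\<in>A. f j) = real k"
        "\<And>t. (\<Prod>j\<in>A. 1 + t * f j) = (1 + t) ^ k"
      by auto
    from insert.prems[of a] consider "f a = 0" | "f a = 1" by auto
    then show ?case
    proof cases
      case 1
      with insert k show ?thesis by (intro exI[of _ k]) auto
    next
      case 2
      with insert k show ?thesis by (intro exI[of _ "Suc k"]) auto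
    qed
  qed
  with that show ?thesis by blast
qed

text \<open>Binomial theorem padded with zero terms: \<open>k\<close> will depend on the outcome,
  while the summation range must not.\<close>

lemma one_plus_power_eq_sum_gchoose:
  fixes t :: real
  assumes "k \<le> n"
  shows "(1 + t) ^ k = (\<Sum>l\<le>n. (real k gchoose l) * t ^ l)"
proof -
  have "(1 + t) ^ k = (\<Sum>l\<le>k. (real k gchoose l) * t ^ l)"
    using binomial_ring[of t 1 k] by (simp add: binomial_gbinomial add.commute)
  also have "\<dots> = (\<Sum>l\<le>n. (real k gchoose l) * t ^ l)"
    using assms by (intro sum.mono_neutral_left) (auto simp flip: binomial_gbinomial)
  finally show ?thesis .
qed

context prob_space
begin

text \<open>The two events are disjoint and their probabilities add up to 1.\<close>

lemma AE_bernoulli: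
  fixes Z :: "'a \<Rightarrow> real"
  assumes [measurable]: "Z \<in> borel_measurable M"
    and "prob {\<omega> \<in> space M. Z \<omega> = 1} = p" "prob {\<omega> \<in> space M. Z \<omega> = 0} = 1 - p"
  shows "AE \<omega> in M. Z \<omega> = 0 \<or> Z \<omega> = 1"
proof -
  have "prob ({\<omega> \<in> space M. Z \<omega> = 1} \<union> {\<omega> \<in> space M. Z \<omega> = 0}) = 1"
    using assms(2,3) by (subst finite_measure_Union) auto
  from AE_prob_1[OF this] show ?thesis
    by eventually_elim auto
qed

text \<open>Almost everywhere \<open>Z\<close> is the indicator of the event that it equals
  1.\<close>

lemma bernoulli_integral:
  fixes Z :: "'a \<Rightarrow> real"
  assumes [measurable]: "Z \<in> borel_measurable M"
    and "AE \<omega> in M. Z \<omega> = 0 \<or> Z \<omega> = 1"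
  shows "integrable M Z" "expectation Z = prob {\<omega> \<in> space M. Z \<omega> = 1}"
proof -
  show "integrable M Z"
    by (rule integrable_const_bound[where B = 1]) (use assms(2) in auto)
  have "expectation Z = expectation (indicator {\<omega> \<in> space M. Z \<omega> = 1})"
    by (rule integral_cong_AE)
      (use assms(2) AE_space in \<open>auto elim!: eventually_rev_mp simp: indicator_def\<close>)
  then show "expectation Z = prob {\<omega> \<in> space M. Z \<omega> = 1}"
    by simp
qed

text \<open>Both sides are the expectation of \<open>(1 + t) ^ Y\<close> for the sum
  \<open>Y\<close> of the variables: on the left by expanding in powers of \<open>t\<close>, on the
  right by independence.\<close>

lemma sum_expectation_gchoose:
  fixes X :: "'b \<Rightarrow> 'a \<Rightarrow> real" and p :: "'b \<Rightarrow> real"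
  assumes fin: "finite I"
    and indep: "indep_vars (\<lambda>_. borel) X I"
    and one: "\<And>j. j \<in> I \<Longrightarrow> prob {\<omega> \<in> space M. X j \<omega> = 1} = p j"
    and zero: "\<And>j. j \<in> I \<Longrightarrow> prob {\<omega> \<in> space M. X j \<omega> = 0} = 1 - p j"
  shows "(\<Sum>l\<le>card I. expectation (\<lambda>\<omega>. (\<Sum>j\<in>I. X j \<omega>) gchoose l) * t ^ l) =
    (\<Prod>j\<in>I. 1 + t * p j)"
proof -
  let ?Y = "\<lambda>\<omega>. \<Sum>j\<in>I. X j \<omega>"
  have meas: "X j \<in> borel_measurable M" if "j \<in> I" for j
    using indep that by (simp add: indep_vars_def)
  then have [measurable]: "?Y \<in> borel_measurable M"
    by (rule borel_measurable_sum)
  have bernoulli: "AE \<omega> in M. X j \<omega> = 0 \<or> X j \<omega> = 1" if "j \<in> I" for j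
    using AE_bernoulli meas one zero that by blast
  then have all_bernoulli: "AE \<omega> in M. \<forall>j\<in>I. X j \<omega> = 0 \<or> X j \<omega> = 1"
    using fin by (simp add: AE_finite_all)
  \<comment> \<open>The generalized binomial is a polynomial in its upper argument, here a finite
    product divided by \<open>fact l\<close>.\<close>
  have gchoose_measurable [measurable]: "(\<lambda>\<omega>. ?Y \<omega> gchoose l) \<in> borel_measurable M" for l
    unfolding gbinomial_prod_rev by measurable
  have gchoose_integrable: "integrable M (\<lambda>\<omega>. ?Y \<omega> gchoose l)" for l
  \<comment> \<open>Almost surely the sum is some natural number \<open>k\<close> up to
    \<open>card I\<close>; adding \<open>k choose l\<close> over all these values gives a constant
    bound.\<close>
  proof (rule integrable_const_bound[where B = "\<Sum>k\<le>card I. real (k choose l)"])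
    show "AE \<omega> in M. norm (?Y \<omega> gchoose l) \<le> (\<Sum>k\<le>card I. real (k choose l))"
      using all_bernoulli
    proof eventually_elim
      case (elim \<omega>)
      then obtain k where k: "k \<le> card I" "?Y \<omega> = real k"
        using zero_one_sum_eq_of_nat[OF fin, of "\<lambda>j. X j \<omega>"] by metis
      then show ?case
        using member_le_sum[of k "{..card I}" "\<lambda>k. real (k choose l)"]
        by (simp flip: binomial_gbinomial)
    qed
  qed simp
  have "(\<Sum>l\<le>card I. expectation (\<lambda>\<omega>. ?Y \<omega> gchoose l) * t ^ l) =
      expectation (\<lambda>\<omega>. \<Sum>l\<le>card I. (?Y \<omega> gchoose l) * t ^ l)"
    using gchoose_integrable by simp
  also have "\<dots> = expectation (\<lambda>\<omega>. \<Prod>j\<in>I. 1 + t * X j \<omega>)"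
  proof (rule integral_cong_AE)
    show "(\<lambda>\<omega>. \<Prod>j\<in>I. 1 + t * X j \<omega>) \<in> borel_measurable M"
      using meas by measurable
    show "AE \<omega> in M. (\<Sum>l\<le>card I. (?Y \<omega> gchoose l) * t ^ l) = (\<Prod>j\<in>I. 1 + t * X j \<omega>)"
      using all_bernoulli
    proof eventually_elim
      case (elim \<omega>)
      then obtain k where "k \<le> card I" "?Y \<omega> = real k"
          "(\<Prod>j\<in>I. 1 + t * X j \<omega>) = (1 + t) ^ k"
        using zero_one_sum_eq_of_nat[OF fin, of "\<lambda>j. X j \<omega>"] by metis
      then show ?case
        by (simp add: one_plus_power_eq_sum_gchoose)
    qed
  qed simp
  also have "\<dots> = (\<Prod>j\<in>I. expectation (\<lambda>\<omega>. 1 + t * X j \<omega>))"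
  proof (rule indep_vars_lebesgue_integral[OF fin])
    show "indep_vars (\<lambda>_. borel) (\<lambda>j \<omega>. 1 + t * X j \<omega>) I"
      by (rule indep_vars_compose2[OF indep]) simp
    show "integrable M (\<lambda>\<omega>. 1 + t * X j \<omega>)" if "j \<in> I" for j
      using bernoulli_integral(1)[OF meas bernoulli] that by simp
  qed
  also have "\<dots> = (\<Prod>j\<in>I. 1 + t * p j)"
    using bernoulli_integral[OF meas bernoulli] one by (intro prod.cong) (auto simp: prob_space)
  finally show ?thesis .
qed

end

theorem theorem3:
  fixes M :: "'a measure" and X :: "nat \<Rightarrow> 'a \<Rightarrow> real"
    and Y :: "'a \<Rightarrow> real" and lam :: real and n l :: nat
  assumes "prob_space M"
    and "0 < lam" "lam < 1"
    and "prob_space.indep_vars M (\<lambda>_. borel) X {1..n}"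
    and "\<And>j. j \<in> {1..n} \<Longrightarrow> measure M {\<omega> \<in> space M. X j \<omega> = 1} = 1 / real j"
    and "\<And>j. j \<in> {1..n} \<Longrightarrow> measure M {\<omega> \<in> space M. X j \<omega> = 0} = 1 - 1 / real j"
    and "\<And>\<omega>. Y \<omega> = (\<Sum>j = 1..n. X j \<omega>)"
    and "l \<le> n"
  shows "(\<Sum>m = l..n. degen_stirling2 lam (n + 1) (m + 1) * stirling1 (m + 1) (l + 1)) =
    (- 1) ^ (n - l) * lam ^ (n - l) * fact n * prob_space.expectation M (\<lambda>\<omega>. Y \<omega> gchoose l)"
proof -
  interpret prob_space M by fact
  let ?E = "\<lambda>k. expectation (\<lambda>\<omega>. Y \<omega> gchoose k)"
  define c where "c k = (\<Sum>m\<le>Suc n. degen_stirling2 lam (Suc n) m * stirling1 m k)" for k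
  \<comment> \<open>The factor \<open>x\<close> of the product shifts every exponent by one, hence
    \<open>k - 1\<close> and a zero constant term.\<close>
  define d where "d k = (if k = 0 then 0 else (- lam) ^ (n - (k - 1)) * fact n * ?E (k - 1))" for k
  have gen: "(\<Sum>k\<le>n. ?E k * t ^ k) = (\<Prod>j=1..n. 1 + t * (1 / real j))" for t
    using sum_expectation_gchoose[OF _ assms(4-6), of t] assms(7) by simp
  have "(\<Sum>k\<le>Suc n. c k * x ^ k) = (\<Sum>k\<le>Suc n. d k * x ^ k)" for x
  proof -
    \<comment> \<open>Since \<open>(- lam) * (- x / lam) = x\<close>, the power of
      \<open>t = - x / lam\<close> absorbs \<open>k\<close> of the \<open>n\<close> factors
      \<open>- lam\<close>.\<close>
    have "(- lam) ^ n * (- x / lam) ^ k = (- lam) ^ (n - k) * x ^ k" if "k \<le> n" for k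
    proof -
      have "(- lam) ^ n = (- lam) ^ (n - k) * (- lam) ^ k"
        using that by (simp flip: power_add)
      moreover have "(- lam) ^ k * (- x / lam) ^ k = x ^ k"
        using assms(2) by (simp flip: power_mult_distrib)
      ultimately show ?thesis by simp
    qed
    then have summand: "x * (- lam) ^ n * fact n * (?E k * (- x / lam) ^ k) = d (Suc k) * x ^ Suc k"
      if "k \<le> n" for k
      using that by (simp add: d_def algebra_simps)
    have "(\<Sum>k\<le>n. d (Suc k) * x ^ Suc k) =
        x * (- lam) ^ n * fact n * (\<Sum>k\<le>n. ?E k * (- x / lam) ^ k)"
      unfolding sum_distrib_left by (rule sum.cong[OF refl], rule summand[symmetric]) simp
    also have "\<dots> = degen_falling lam x (Suc n)"
      unfolding gen using assms(2) by (subst degen_falling_Suc_eq_prod) simp_all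
    finally have "(\<Sum>k\<le>n. d (Suc k) * x ^ Suc k) = degen_falling lam x (Suc n)" .
    then show ?thesis
      unfolding degen_falling_eq_sum_power c_def[symmetric]
      by (subst (2) sum.atMost_Suc_shift) (simp add: d_def)
  qed
  then have "c (Suc l) = d (Suc l)"
    by (rule power_series_coeff_unique) (use assms(8) in simp)
  \<comment> \<open>The term for \<open>m = 0\<close> drops out because
    \<open>stirling1 0 (Suc l) = 0\<close>; the remaining indices are shifted to
    \<open>Suc m\<close>.\<close>
  moreover have "c (Suc l) =
      (\<Sum>m\<le>n. degen_stirling2 lam (Suc n) (Suc m) * stirling1 (Suc m) (Suc l))"
    unfolding c_def by (subst sum.atMost_Suc_shift) (simp add: stirling1_eq_0)
  \<comment> \<open>For \<open>m < l\<close> the factor \<open>stirling1 (Suc m) (Suc l)\<close>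
    vanishes.\<close>
  moreover have "\<dots> =
      (\<Sum>m=l..n. degen_stirling2 lam (Suc n) (Suc m) * stirling1 (Suc m) (Suc l))"
    by (rule sum.mono_neutral_right) (auto simp: stirling1_eq_0)
  ultimately show ?thesis
    by (simp add: d_def flip: power_mult_distrib)
qed

end
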